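(* Let $(\mathcal{G},c)$ be a coloured DAG with compatible colouring $c$. The RDAG model on $(\mathcal{G},c)$ is equal to the RCON model on $(\mathcal{G}^u,c)$ if and only if the following three conditions hold: (a) $\mathcal{G}$ has no unshielded colliders; (b) $\mathcal{G}_i \simeq \mathcal{G}_j$ for every pair of vertices $i,j$ of the same colour; and (c) $\mathcal{G}_{(j\to i)} \simeq \mathcal{G}_{(l\to k)}$ for every pair of edges $j\to i$ and $l\to k$ of the same colour.
   Context: $\mathcal{G}=(I,E)$ is a directed acyclic graph (DAG) with vertex set $I=[m]=\{1,\dots,m\}$ and edge set $E$ (no loops, no multiple edges); $j\to i$ denotes an edge from $j$ to $i$. Vertices are ordered so that $j\to i$ in $E$ implies $j>i$. The children of $i$ are $\mathrm{ch}(i)=\{k\in I \mid (i\to k)\in E\}$. A coloured DAG $(\mathcal{G},c)$ is a DAG with a map $c: I\cup E\to \mathcal{C}$ to a set of colours; $c(i)$ is the colour of vertex $i$ and $c(ij)$ is the colour of the edge $j\to i$. The colouring $c$ is compatible if (i) vertex colours and edge colours are disjoint, and (ii) whenever edges $j\to i$ and $l\to k$ satisfy $c(ij)=c(kl)$, then $c(i)=c(k)$. The RDAG model on $(\mathcal{G},c)$ is the set of all matrices $\Psi=(\mathrm{id}-\Lambda)^{\mathsf T}\Omega^{-1}(\mathrm{id}-\Lambda)$, where $\Lambda\in\mathbb{R}^{m\times m}$ satisfies $\lambda_{ij}=0$ unless $j\to i$ in $\mathcal{G}$ and $\lambda_{ij}=\lambda_{kl}$ whenever edges $j\to i$ and $l\to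 k$ have the same colour, and $\Omega\in\mathbb{R}^{m\times m}$ is diagonal with positive diagonal entries satisfying $\omega_{ii}=\omega_{jj}$ whenever vertices $i,j$ have the same colour. $(\mathcal{G}^u,c)$ is the coloured undirected graph obtained by forgetting edge directions and keeping all colours. The RCON model on a coloured undirected graph is the set of real symmetric positive definite $m\times m$ matrices $\Psi$ with $\Psi_{ij}=0$ whenever $i\neq j$ and $i - j$ is not an edge, $\Psi_{ii}=\Psi_{jj}$ whenever $c(i)=c(j)$, and $\Psi_{ij}=\Psi_{kl}$ whenever edges $i-j$ and $k-l$ have the same colour. An unshielded collider is a triple of distinct vertices $i,j,k$ with $i\to k\leftarrow j$ in $\mathcal{G}$ and no edge between $i$ and $j$ (in either direction). For a vertex $i$, $\mathcal{G}_i$ is the coloured graph on vertex set $\{i\}\cup\mathrm{ch}(i)$ with edges $i\to k$ for each $k\in\mathrm{ch}(i)$, and vertex and edge colours inherited from $(\mathcal{G},c)$. For an edge $j\to i$, $\mathcal{G}_{(j\to i)}$ is the coloured (multi)graph on vertex set $\{i\}\cup(\mathrm{ch}(i)\cap\mathrm{ch}(j))$ with vertex colours inherited from $(\mathcal{G},c)$ and, for each $k\in\mathrm{ch}(i)\cap\mathrm{ch}(j)$, two edges $i\to k$, one of colour $c(ki)$ and the other of colour $c(kj)$. The notation $\simeq$ means isomorphism of coloured graphs, i.e. equality (including vertex and edge colours) up to relabelling vertices. *)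

theory Defs
  imports "HOL-Analysis.Analysis" "Graph_Theory.Digraph_Isomorphism"
begin

text \<open>
  The vertex set \<open>I = [m]\<close> is the whole of a finite linearly ordered type \<open>'n\<close>, with \<open>m = CARD('n)\<close>.
  The edge \<open>j \<rightarrow> i\<close> is the pair \<open>(j, i)\<close>. Note the order of the indices: it carries
  the matrix entry \<open>\<lambda>\<^sub>i\<^sub>j = \<Lambda> $ i $ j\<close> and the colour \<open>c(ij) = c (Inr (j, i))\<close>.
  A colouring of the disjoint union of vertices and edges is a function on a sum type;
  its values outside the edge set are never used.
\<close>

type_synonym ('n, 'c) dag_colouring = "'n + 'n \<times> 'n \<Rightarrow> 'c"
type_synonym ('n, 'c) ugraph_colouring = "'n + 'n set \<Rightarrow> 'c"

definition ordered_dag :: "('n::linorder \<times> 'n) set \<Rightarrow> bool" where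
  "ordered_dag E \<longleftrightarrow> acyclic E \<and> (\<forall>i j. (j, i) \<in> E \<longrightarrow> j > i)"

definition compatible_colouring :: "('n \<times> 'n) set \<Rightarrow> ('n, 'c) dag_colouring \<Rightarrow> bool" where
  "compatible_colouring E c \<longleftrightarrow>
     (\<forall>v. \<forall>e\<in>E. c (Inl v) \<noteq> c (Inr e)) \<and>
     (\<forall>i j k l. (j, i) \<in> E \<longrightarrow> (l, k) \<in> E \<longrightarrow> c (Inr (j, i)) = c (Inr (l, k)) \<longrightarrow> c (Inl i) = c (Inl k))"

definition children :: "('n \<times> 'n) set \<Rightarrow> 'n \<Rightarrow> 'n set" where
  "children E i = {k. (i, k) \<in> E}"

definition RDAG :: "('n::finite \<times> 'n) set \<Rightarrow> ('n, 'c) dag_colouring \<Rightarrow> (real ^ 'n ^ 'n) set" where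
  "RDAG E c =
     {transpose (mat 1 - \<Lambda>) ** matrix_inv \<Omega> ** (mat 1 - \<Lambda>) | \<Lambda> \<Omega>.
        (\<forall>i j. (j, i) \<notin> E \<longrightarrow> \<Lambda> $ i $ j = 0) \<and>
        (\<forall>i j k l. (j, i) \<in> E \<longrightarrow> (l, k) \<in> E \<longrightarrow> c (Inr (j, i)) = c (Inr (l, k)) \<longrightarrow>
           \<Lambda> $ i $ j = \<Lambda> $ k $ l) \<and>
        (\<forall>i j. i \<noteq> j \<longrightarrow> \<Omega> $ i $ j = 0) \<and>
        (\<forall>i. \<Omega> $ i $ i > 0) \<and>
        (\<forall>i j. c (Inl i) = c (Inl j) \<longrightarrow> \<Omega> $ i $ i = \<Omega> $ j $ j)}"

definition sym_pos_def :: "real ^ 'n ^ 'n \<Rightarrow> bool" where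
  "sym_pos_def A \<longleftrightarrow> transpose A = A \<and> (\<forall>x. x \<noteq> 0 \<longrightarrow> x \<bullet> (A *v x) > 0)"

text \<open>The edges of an undirected graph are given as two-element sets.\<close>

definition RCON :: "'n::finite set set \<Rightarrow> ('n, 'c) ugraph_colouring \<Rightarrow> (real ^ 'n ^ 'n) set" where
  "RCON U d =
     {\<Psi>. sym_pos_def \<Psi> \<and>
        (\<forall>i j. i \<noteq> j \<longrightarrow> {i, j} \<notin> U \<longrightarrow> \<Psi> $ i $ j = 0) \<and>
        (\<forall>i j. d (Inl i) = d (Inl j) \<longrightarrow> \<Psi> $ i $ i = \<Psi> $ j $ j) \<and>
        (\<forall>i j k l. {i, j} \<in> U \<longrightarrow> {k, l} \<in> U \<longrightarrow> d (Inr {i, j}) = d (Inr {k, l}) \<longrightarrow>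
           \<Psi> $ i $ j = \<Psi> $ k $ l)}"

definition undirected :: "('n \<times> 'n) set \<Rightarrow> 'n set set" where
  "undirected E = {{j, i} | i j. (j, i) \<in> E}"

definition undirected_colouring ::
    "('n \<times> 'n) set \<Rightarrow> ('n, 'c) dag_colouring \<Rightarrow> ('n, 'c) ugraph_colouring" where
  "undirected_colouring E c x =
     (case x of
        Inl v \<Rightarrow> c (Inl v)
      | Inr e \<Rightarrow> c (Inr (THE a. a \<in> E \<and> e = {fst a, snd a})))"

text \<open>In a DAG every undirected edge comes from exactly one directed edge, so that forgetting
  directions keeps all edge colours.\<close>

lemma undirected_colouring_Inr:
  assumes "ordered_dag E" "(j, i) \<in> E"
  shows "undirected_colouring E c (Inr {j, i}) = c (Inr (j, i))"
proof -
  have "(i, j) \<notin> E"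
    using assms by (meson ordered_dag_def order.asym)
  then have "(THE a. a \<in> E \<and> {j, i} = {fst a, snd a}) = (j, i)"
    using assms by (intro the_equality) (auto simp: ordered_dag_def doubleton_eq_iff)
  then show ?thesis by (simp add: undirected_colouring_def)
qed

definition unshielded_collider :: "('n \<times> 'n) set \<Rightarrow> 'n \<Rightarrow> 'n \<Rightarrow> 'n \<Rightarrow> bool" where
  "unshielded_collider E i j k \<longleftrightarrow>
     i \<noteq> j \<and> i \<noteq> k \<and> j \<noteq> k \<and> (i, k) \<in> E \<and> (j, k) \<in> E \<and> (i, j) \<notin> E \<and> (j, i) \<notin> E"

record ('v, 'a, 'c) coloured_multigraph =
  shape :: "('v, 'a) pre_digraph"
  vcolour :: "'v \<Rightarrow> 'c"
  acolour :: "'a \<Rightarrow> 'c"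

definition coloured_iso ::
    "('v, 'a, 'c) coloured_multigraph \<Rightarrow> ('w, 'b, 'c) coloured_multigraph \<Rightarrow> bool" where
  "coloured_iso G H \<longleftrightarrow>
     (\<exists>h. pre_digraph.digraph_isomorphism (shape G) h \<and> shape H = app_iso h (shape G) \<and>
        (\<forall>v\<in>verts (shape G). vcolour H (iso_verts h v) = vcolour G v) \<and>
        (\<forall>a\<in>arcs (shape G). acolour H (iso_arcs h a) = acolour G a))"

definition vertex_graph ::
    "('n \<times> 'n) set \<Rightarrow> ('n, 'c) dag_colouring \<Rightarrow> 'n \<Rightarrow> ('n, 'n \<times> 'n, 'c) coloured_multigraph" where
  "vertex_graph E c i =
     \<lparr>shape = \<lparr>verts = insert i (children E i), arcs = {i} \<times> children E i, tail = fst, head = snd\<rparr>,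
      vcolour = (\<lambda>v. c (Inl v)), acolour = (\<lambda>a. c (Inr a))\<rparr>"

text \<open>
  \<open>\<G>\<^bsub>(j \<rightarrow> i)\<^esub>\<close> is \<open>edge_graph E c j i\<close>. For every common child \<open>k\<close> it has two parallel arcs from
  \<open>i\<close> to \<open>k\<close>. They are named \<open>(i, k)\<close> and \<open>(j, k)\<close>, after the edges of the DAG whose colours
  they carry, but both have tail \<open>i\<close>.
\<close>

definition edge_graph ::
    "('n \<times> 'n) set \<Rightarrow> ('n, 'c) dag_colouring \<Rightarrow> 'n \<Rightarrow> 'n \<Rightarrow> ('n, 'n \<times> 'n, 'c) coloured_multigraph" where
  "edge_graph E c j i =
     \<lparr>shape = \<lparr>verts = insert i (children E i \<inter> children E j),
               arcs = {i, j} \<times> (children E i \<inter> children E j),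
               tail = (\<lambda>_. i), head = snd\<rparr>,
      vcolour = (\<lambda>v. c (Inl v)), acolour = (\<lambda>a. c (Inr a))\<rparr>"

end

theory Submission
  imports Defs
begin

text \<open>
  With \<open>\<alpha>\<^sub>k = 1 / \<omega>\<^sub>k\<^sub>k\<close>, a matrix of the RDAG model has the entries
  \<open>\<Psi>\<^sub>i\<^sub>j = of_bool (i = j) \<alpha>\<^sub>i - \<lambda>\<^sub>i\<^sub>j \<alpha>\<^sub>i - \<lambda>\<^sub>j\<^sub>i \<alpha>\<^sub>j + \<Sum>\<^sub>k \<lambda>\<^sub>k\<^sub>i \<lambda>\<^sub>k\<^sub>j \<alpha>\<^sub>k\<close>,
  where \<open>k\<close> runs through the common children of \<open>i\<close> and \<open>j\<close>.

  The two isomorphism conditions both say that the common children of two vertices can be matched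
  with those of two other vertices so that the unordered pair of edge colours at each common child
  is preserved: \<open>children_match E c i j k l\<close>, with \<open>i = j\<close> and \<open>k = l\<close> in the
  case of vertices (\<open>vertex_iso_iff\<close>, \<open>edge_iso_iff\<close>). The vertex colours of matched children
  then agree because the colouring is compatible.

  The three conditions hold if and only if the RDAG model is contained in the RCON model
  (\<open>RDAG_subset_RCON_iff\<close>). If they hold, the sums above are zero for non-adjacent vertices and
  depend only on the colour of \<open>i\<close> or of the edge \<open>j \<rightarrow> i\<close>. For the converse, take
  \<open>\<Omega> = id\<close> and let \<open>\<lambda>\<close> be the indicator of a set \<open>S\<close> of edge colours. The sum then
  counts the common children whose pair of colours lies in \<open>S\<close>. When \<open>S\<close> contains all colours
  this excludes unshielded colliders; by inclusion-exclusion, these counts for all \<open>S\<close> determine how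
  often each pair of colours occurs, and hence give a matching.

  The three conditions also imply the other inclusion (\<open>RCON_subset_RDAG\<close>). Every positive definite
  \<open>\<Psi>\<close> factors as in the uncoloured model of the complete graph (\<open>LDL_factorisation\<close>), and the formula
  for \<open>\<Psi>\<^sub>i\<^sub>j\<close> expresses \<open>\<alpha>\<^sub>i\<close> and \<open>\<lambda>\<^sub>i\<^sub>j\<close> by \<open>\<Psi>\<close> and by
  the parameters at vertices below \<open>i\<close>. Induction on \<open>i\<close> shows that \<open>\<Lambda>\<close> is supported
  on the edges, since there are no unshielded colliders, and that the parameters respect the
  colours, by the matchings.
\<close>

section \<open>Colour-preserving matchings\<close>

lemma bij_betw_from_fibre_cards:
  assumes "finite A" "finite B"
    and eq: "\<And>T. card {a \<in> A. f a = T} = card {b \<in> B. g b = T}"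
  shows "\<exists>h. bij_betw h A B \<and> (\<forall>a\<in>A. g (h a) = f a)"
proof -
  have "\<exists>h. bij_betw h {a \<in> A. f a = T} {b \<in> B. g b = T}" for T
    using assms by (intro finite_same_card_bij) auto
  then obtain H where H: "\<And>T. bij_betw (H T) {a \<in> A. f a = T} {b \<in> B. g b = T}"
    by metis
  let ?h = "\<lambda>a. H (f a) a"
  have mem: "?h a \<in> B \<and> g (?h a) = f a" if "a \<in> A" for a
    using bij_betwE[OF H[of "f a"]] that by auto
  have "inj_on ?h A"
  proof (rule inj_onI)
    fix a a' assume *: "a \<in> A" "a' \<in> A" "?h a = ?h a'"
    then have "f a = f a'" using mem by metis
    with * show "a = a'"
      using bij_betw_imp_inj_on[OF H[of "f a"]] by (auto dest: inj_onD)
  qed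
  moreover have "?h ` A = B"
  proof
    show "?h ` A \<subseteq> B" using mem by auto
    show "B \<subseteq> ?h ` A"
    proof
      fix b assume "b \<in> B"
      then have "b \<in> H (g b) ` {a \<in> A. f a = g b}"
        using bij_betw_imp_surj_on[OF H[of "g b"]] by auto
      then obtain a where "a \<in> A" "b = ?h a" by auto
      then show "b \<in> ?h ` A" by blast
    qed
  qed
  ultimately have "bij_betw ?h A B" by (simp add: bij_betw_def)
  with mem show ?thesis by blast
qed

text \<open>Moebius inversion over the subsets of \<open>T\<close>, in the form of an induction on \<open>T\<close>.\<close>

lemma fibre_cards_from_subset_cards:
  fixes f :: "'a \<Rightarrow> 'c set" and g :: "'b \<Rightarrow> 'c set"
  assumes fin: "finite A" "finite B"
    and ff: "\<And>a. a \<in> A \<Longrightarrow> finite (f a)" and fg: "\<And>b. b \<in> B \<Longrightarrow> finite (g b)"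
    and eq: "\<And>S. card {a \<in> A. f a \<subseteq> S} = card {b \<in> B. g b \<subseteq> S}"
  shows "card {a \<in> A. f a = T} = card {b \<in> B. g b = T}"
proof (cases "finite T")
  case True
  have split: "card {a \<in> X. u a \<subseteq> T} = card {a \<in> X. u a = T} + (\<Sum>T'\<in>{T'. T' \<subset> T}. card {a \<in> X. u a = T'})"
    if "finite X" "finite T" for X :: "'d set" and u :: "'d \<Rightarrow> 'c set" and T
  proof -
    have finT: "finite {T'. T' \<subset> T}"
      by (rule finite_subset[of _ "Pow T"]) (use that in auto)
    have "{a \<in> X. u a \<subseteq> T} = {a \<in> X. u a = T} \<union> (\<Union>T'\<in>{T'. T' \<subset> T}. {a \<in> X. u a = T'})"
      by auto
    also have "card \<dots> = card {a \<in> X. u a = T} + card (\<Union>T'\<in>{T'. T' \<subset> T}. {a \<in> X. u a = T'})"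
      using that finT by (intro card_Un_disjoint) auto
    also have "card (\<Union>T'\<in>{T'. T' \<subset> T}. {a \<in> X. u a = T'}) = (\<Sum>T'\<in>{T'. T' \<subset> T}. card {a \<in> X. u a = T'})"
      using that finT by (intro card_UN_disjoint) auto
    finally show ?thesis .
  qed
  from True show ?thesis
  proof (induction T rule: finite_psubset_induct)
    case (psubset T)
    have "(\<Sum>T'\<in>{T'. T' \<subset> T}. card {a \<in> A. f a = T'}) = (\<Sum>T'\<in>{T'. T' \<subset> T}. card {b \<in> B. g b = T'})"
      using psubset.IH by (intro sum.cong) auto
    with split[OF fin(1) psubset.hyps, of f] split[OF fin(2) psubset.hyps, of g] eq[of T]
    show ?case by linarith
  qed
next
  case False
  then have "{a \<in> A. f a = T} = {}" "{b \<in> B. g b = T} = {}" using ff fg by auto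
  then show ?thesis by (simp only: card.empty)
qed

definition common_children :: "('n \<times> 'n) set \<Rightarrow> 'n \<Rightarrow> 'n \<Rightarrow> 'n set" where
  "common_children E i j = children E i \<inter> children E j"

text \<open>The colours of the edges from \<open>i\<close> and from \<open>j\<close> to \<open>v\<close>, without their order. Equality of
  two such sets is equality of the two-element multisets.\<close>

definition pair_colours :: "('n, 'c) dag_colouring \<Rightarrow> 'n \<Rightarrow> 'n \<Rightarrow> 'n \<Rightarrow> 'c set" where
  "pair_colours c i j v = {c (Inr (i, v)), c (Inr (j, v))}"

text \<open>The common children of \<open>i\<close> and \<open>j\<close> correspond to those of \<open>k\<close> and \<open>l\<close>, with the same
  unordered pairs of edge colours. For \<open>i = j\<close> and \<open>k = l\<close> this compares the colours of the
  edges that leave \<open>i\<close> and \<open>k\<close>.\<close>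

definition children_match ::
    "('n \<times> 'n) set \<Rightarrow> ('n, 'c) dag_colouring \<Rightarrow> 'n \<Rightarrow> 'n \<Rightarrow> 'n \<Rightarrow> 'n \<Rightarrow> bool" where
  "children_match E c i j k l \<longleftrightarrow>
     (\<exists>h. bij_betw h (common_children E i j) (common_children E k l) \<and>
          (\<forall>v\<in>common_children E i j. pair_colours c k l (h v) = pair_colours c i j v))"

lemma children_match_from_counts:
  fixes E :: "('n::finite \<times> 'n) set"
  assumes "\<And>S. card {v \<in> common_children E i j. pair_colours c i j v \<subseteq> S}
             = card {v \<in> common_children E k l. pair_colours c k l v \<subseteq> S}"
  shows "children_match E c i j k l"
  unfolding children_match_def
  by (intro bij_betw_from_fibre_cards fibre_cards_from_subset_cards assms)
     (auto simp: pair_colours_def)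

lemma compatible_colouringD:
  assumes "compatible_colouring E c" "(j, i) \<in> E" "(l, k) \<in> E" "c (Inr (j, i)) = c (Inr (l, k))"
  shows "c (Inl i) = c (Inl k)"
  using assms unfolding compatible_colouring_def by blast

lemma ordered_dagD:
  assumes "ordered_dag E" "(j, i) \<in> E"
  shows "i < j"
  using assms unfolding ordered_dag_def by blast

lemma matched_child_vertex_colour:
  assumes "compatible_colouring E c" "v \<in> common_children E i j" "w \<in> common_children E k l"
    and "pair_colours c k l w = pair_colours c i j v"
  shows "c (Inl w) = c (Inl v)"
proof -
  have "c (Inr (k, w)) \<in> {c (Inr (i, v)), c (Inr (j, v))}"
    using assms(4) by (auto simp: pair_colours_def)
  with assms(1-3) show ?thesis
    by (auto simp: common_children_def children_def dest: compatible_colouringD)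
qed

section \<open>Isomorphisms of the local graphs\<close>

lemma vertex_iso_iff:
  fixes E :: "('n::linorder \<times> 'n) set"
  assumes ord: "ordered_dag E" and comp: "compatible_colouring E c" and col: "c (Inl i) = c (Inl j)"
  shows "coloured_iso (vertex_graph E c i) (vertex_graph E c j) \<longleftrightarrow> children_match E c i i j j"
proof
  assume "coloured_iso (vertex_graph E c i) (vertex_graph E c j)"
  then obtain h where
      iso: "pre_digraph.digraph_isomorphism (shape (vertex_graph E c i)) h"
    and sh: "shape (vertex_graph E c j) = app_iso h (shape (vertex_graph E c i))"
    and ac: "\<forall>a\<in>arcs (shape (vertex_graph E c i)). acolour (vertex_graph E c j) (iso_arcs h a)
              = acolour (vertex_graph E c i) a"
    unfolding coloured_iso_def by blast
  have inj: "inj_on (iso_arcs h) ({i} \<times> children E i)"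
    using iso by (simp add: pre_digraph.digraph_isomorphism_def vertex_graph_def)
  have img: "iso_arcs h ` ({i} \<times> children E i) = {j} \<times> children E j"
    using sh by (simp add: vertex_graph_def app_iso_def)
  have "bij_betw (snd \<circ> (iso_arcs h \<circ> Pair i)) (children E i) (children E j)"
  proof -
    have "bij_betw (Pair i) (children E i) ({i} \<times> children E i)"
      by (auto simp: bij_betw_def inj_on_def)
    moreover have "bij_betw (iso_arcs h) ({i} \<times> children E i) ({j} \<times> children E j)"
      using inj img by (simp add: bij_betw_def)
    moreover have "bij_betw snd ({j} \<times> children E j) (children E j)"
      by (auto simp: bij_betw_def inj_on_def)
    ultimately show ?thesis by (blast intro: bij_betw_trans)
  qed
  moreover have "c (Inr (j, snd (iso_arcs h (i, v)))) = c (Inr (i, v))" if "v \<in> children E i" for v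
  proof -
    have "iso_arcs h (i, v) \<in> {j} \<times> children E j" using img that by blast
    then have "iso_arcs h (i, v) = (j, snd (iso_arcs h (i, v)))" by auto
    then show ?thesis using ac that by (auto simp: vertex_graph_def)
  qed
  ultimately show "children_match E c i i j j"
    unfolding children_match_def common_children_def pair_colours_def
    by (intro exI[of _ "snd \<circ> (iso_arcs h \<circ> Pair i)"]) auto
next
  assume "children_match E c i i j j"
  then obtain h where bij: "bij_betw h (children E i) (children E j)"
    and h: "\<And>v. v \<in> children E i \<Longrightarrow> c (Inr (j, h v)) = c (Inr (i, v))"
    unfolding children_match_def common_children_def pair_colours_def by auto
  have irr: "p \<notin> children E p" for p
    using ordered_dagD[OF ord, of p p] by (auto simp: children_def)
  have hch: "h v \<in> children E j" if "v \<in> children E i" for v using bij that by (auto dest: bij_betwE)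
  have vc: "c (Inl (h v)) = c (Inl v)" if "v \<in> children E i" for v
    using compatible_colouringD[OF comp _ _ h[OF that]] that hch[OF that] by (auto simp: children_def)
  define g where "g = h(i := j)"
  have gi: "g i = j" by (simp add: g_def)
  let ?f = "\<lparr>iso_verts = g, iso_arcs = (\<lambda>a. (j, h (snd a))), iso_head = snd, iso_tail = fst\<rparr>
            :: ('n, 'n \<times> 'n, 'n, 'n \<times> 'n) digraph_isomorphism"
  have hi: "g v = h v" if "v \<in> children E i" for v using irr that by (auto simp: g_def)
  have inj: "inj_on h (children E i)" and img: "h ` children E i = children E j"
    using bij by (auto simp: bij_betw_def)
  have img': "g ` children E i = children E j"
    using img hi by (metis image_cong)
  show "coloured_iso (vertex_graph E c i) (vertex_graph E c j)"
    unfolding coloured_iso_def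
  proof (intro exI[of _ ?f] conjI)
    show "pre_digraph.digraph_isomorphism (shape (vertex_graph E c i)) ?f"
      unfolding pre_digraph.digraph_isomorphism_def
    proof (intro conjI)
      show "wf_digraph (shape (vertex_graph E c i))"
        by unfold_locales (auto simp: vertex_graph_def)
      show "inj_on (iso_verts ?f) (verts (shape (vertex_graph E c i)))"
        using inj irr hch hi gi by (fastforce simp: vertex_graph_def inj_on_def)
      show "inj_on (iso_arcs ?f) (arcs (shape (vertex_graph E c i)))"
        using inj by (auto simp: vertex_graph_def inj_on_def)
    qed (use hi gi in \<open>auto simp: vertex_graph_def\<close>)
    have "(\<lambda>a. (j, h (snd a))) ` ({i} \<times> children E i) = {j} \<times> children E j"
      unfolding img[symmetric] by force
    then show "shape (vertex_graph E c j) = app_iso ?f (shape (vertex_graph E c i))"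
      using img' gi by (simp add: vertex_graph_def app_iso_def)
  qed (use col vc hi gi h in \<open>auto simp: vertex_graph_def\<close>)
qed

lemma edge_iso_iff:
  fixes E :: "('n::linorder \<times> 'n) set"
  assumes ord: "ordered_dag E" and comp: "compatible_colouring E c"
    and e: "(j, i) \<in> E" "(l, k) \<in> E" and col: "c (Inr (j, i)) = c (Inr (l, k))"
  shows "coloured_iso (edge_graph E c j i) (edge_graph E c l k) \<longleftrightarrow> children_match E c i j k l"
proof -
  define A where "A = common_children E i j"
  define B where "B = common_children E k l"
  have ne: "i \<noteq> j" "k \<noteq> l" using ordered_dagD[OF ord] e by auto
  have G: "edge_graph E c j i = \<lparr>shape = \<lparr>verts = insert i A, arcs = {i, j} \<times> A,
               tail = (\<lambda>_. i), head = snd\<rparr>, vcolour = (\<lambda>v. c (Inl v)), acolour = (\<lambda>a. c (Inr a))\<rparr>"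
    and H: "edge_graph E c l k = \<lparr>shape = \<lparr>verts = insert k B, arcs = {k, l} \<times> B,
               tail = (\<lambda>_. k), head = snd\<rparr>, vcolour = (\<lambda>v. c (Inl v)), acolour = (\<lambda>a. c (Inr a))\<rparr>"
    by (simp_all add: edge_graph_def A_def B_def common_children_def)
  have iA: "i \<notin> A" and kB: "k \<notin> B"
    using ordered_dagD[OF ord, of i i] ordered_dagD[OF ord, of k k]
    by (auto simp: A_def B_def common_children_def children_def)
  show ?thesis
  proof
    assume "coloured_iso (edge_graph E c j i) (edge_graph E c l k)"
    then obtain f where
        iso: "pre_digraph.digraph_isomorphism (shape (edge_graph E c j i)) f"
      and sh: "shape (edge_graph E c l k) = app_iso f (shape (edge_graph E c j i))"
      and ac: "\<forall>a\<in>arcs (shape (edge_graph E c j i)). acolour (edge_graph E c l k) (iso_arcs f a)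
                = acolour (edge_graph E c j i) a"
      unfolding coloured_iso_def by blast
    have hd: "iso_head f = snd" using sh by (simp add: G H app_iso_def)
    have inja: "inj_on (iso_arcs f) ({i, j} \<times> A)" and injv: "inj_on (iso_verts f) A"
      using iso by (auto simp: pre_digraph.digraph_isomorphism_def G inj_on_def)
    have img: "iso_arcs f ` ({i, j} \<times> A) = {k, l} \<times> B"
      using sh by (simp add: G H app_iso_def)
    have snd: "snd (iso_arcs f (p, v)) = iso_verts f v" if "p \<in> {i, j}" "v \<in> A" for p v
      using iso that hd by (auto simp: pre_digraph.digraph_isomorphism_def G)
    have arc: "iso_arcs f (p, v) = (k, iso_verts f v) \<or> iso_arcs f (p, v) = (l, iso_verts f v)"
      and inB: "iso_verts f v \<in> B" if "p \<in> {i, j}" "v \<in> A" for p v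
    proof -
      have "iso_arcs f (p, v) \<in> {k, l} \<times> B" using img that by blast
      with snd[OF that] show "iso_arcs f (p, v) = (k, iso_verts f v) \<or> iso_arcs f (p, v) = (l, iso_verts f v)"
        and "iso_verts f v \<in> B" by (auto simp: prod_eq_iff)
    qed
    have "B \<subseteq> iso_verts f ` A"
    proof
      fix w assume "w \<in> B"
      then have "(k, w) \<in> iso_arcs f ` ({i, j} \<times> A)" using img by blast
      then obtain p v where "p \<in> {i, j}" "v \<in> A" "(k, w) = iso_arcs f (p, v)" by auto
      then have "w = iso_verts f v" using snd[of p v] by (metis snd_conv)
      with \<open>v \<in> A\<close> show "w \<in> iso_verts f ` A" by blast
    qed
    then have "bij_betw (iso_verts f) A B"
      using injv inB by (auto simp: bij_betw_def)
    moreover have "pair_colours c k l (iso_verts f v) = pair_colours c i j v" if v: "v \<in> A" for v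
    proof -
      have "iso_arcs f (i, v) \<noteq> iso_arcs f (j, v)"
        using inja v ne by (auto simp: inj_on_def)
      then have "{iso_arcs f (i, v), iso_arcs f (j, v)} = {(k, iso_verts f v), (l, iso_verts f v)}"
        using arc[of i v] arc[of j v] v by auto
      then have "(\<lambda>a. c (Inr a)) ` {(k, iso_verts f v), (l, iso_verts f v)}
          = (\<lambda>a. c (Inr a)) ` {iso_arcs f (i, v), iso_arcs f (j, v)}" by (rule arg_cong[OF sym])
      also have "\<dots> = {c (Inr (i, v)), c (Inr (j, v))}"
        using ac v by (simp add: G H)
      finally have "(\<lambda>a. c (Inr a)) ` {(k, iso_verts f v), (l, iso_verts f v)}
          = {c (Inr (i, v)), c (Inr (j, v))}" .
      then show ?thesis by (simp add: pair_colours_def)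
    qed
    ultimately show "children_match E c i j k l"
      unfolding children_match_def A_def B_def by blast
  next
    assume "children_match E c i j k l"
    then obtain h where bij: "bij_betw h A B"
      and h: "\<And>v. v \<in> A \<Longrightarrow> pair_colours c k l (h v) = pair_colours c i j v"
      unfolding children_match_def A_def B_def by blast
    have inj: "inj_on h A" and img: "h ` A = B" using bij by (auto simp: bij_betw_def)
    have hB: "h v \<in> B" if "v \<in> A" for v using img that by blast
    have vc: "c (Inl (h v)) = c (Inl v)" if "v \<in> A" for v
      using matched_child_vertex_colour[OF comp, of v i j "h v" k l] h that hB by (simp add: A_def B_def)
    \<comment> \<open>The two parallel arcs at \<open>v\<close> go to the arcs at \<open>h v\<close> straight or crossed, whichever
      preserves their colours.\<close>
    define s where "s p v = (if (p = i) = (c (Inr (k, h v)) = c (Inr (i, v))) then k else l)" for p v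
    define g where "g a = (s (fst a) (snd a), h (snd a))" for a
    have s: "s i v = k \<and> s j v = l \<or> s i v = l \<and> s j v = k" for v
      using ne by (auto simp: s_def)
    have gc: "c (Inr (g (p, v))) = c (Inr (p, v))" if "p \<in> {i, j}" "v \<in> A" for p v
      using h[of v] that ne by (auto simp: g_def s_def pair_colours_def doubleton_eq_iff)
    have gimg: "g ` ({i, j} \<times> A) = {k, l} \<times> B"
    proof -
      have sw: "{(s i v, h v), (s j v, h v)} = {(k, h v), (l, h v)}" for v
        using s[of v] by (auto simp: insert_commute)
      have "{i, j} \<times> A = (\<Union>v\<in>A. {(i, v), (j, v)})" by auto
      then have "g ` ({i, j} \<times> A) = (\<Union>v\<in>A. {(s i v, h v), (s j v, h v)})"
        by (simp add: image_UN g_def)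
      also have "\<dots> = (\<Union>v\<in>A. {(k, h v), (l, h v)})" by (simp only: sw)
      also have "\<dots> = {k, l} \<times> B" using img by auto
      finally show ?thesis .
    qed
    have ginj: "inj_on g ({i, j} \<times> A)"
    proof (rule inj_onI, clarify)
      fix p v q w assume *: "v \<in> A" "w \<in> A" "g (p, v) = g (q, w)" "p \<in> {i, j}" "q \<in> {i, j}"
      then have "v = w" using inj by (auto simp: g_def inj_on_def)
      moreover have "p = q" using * \<open>v = w\<close> s[of v] ne by (auto simp: g_def)
      ultimately show "p = q \<and> v = w" by simp
    qed
    define hv where "hv = h(i := k)"
    have hvi: "hv i = k" by (simp add: hv_def)
    let ?f = "\<lparr>iso_verts = hv, iso_arcs = g, iso_head = snd, iso_tail = (\<lambda>_. k)\<rparr>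
            :: ('n, 'n \<times> 'n, 'n, 'n \<times> 'n) digraph_isomorphism"
    have hi: "hv v = h v" if "v \<in> A" for v using iA that by (auto simp: hv_def)
    have img': "hv ` A = B" using img hi by (metis image_cong)
    show "coloured_iso (edge_graph E c j i) (edge_graph E c l k)"
      unfolding coloured_iso_def
    proof (intro exI[of _ ?f] conjI)
      show "pre_digraph.digraph_isomorphism (shape (edge_graph E c j i)) ?f"
        unfolding pre_digraph.digraph_isomorphism_def
      proof (intro conjI)
        show "wf_digraph (shape (edge_graph E c j i))"
          by unfold_locales (auto simp: G)
        show "inj_on (iso_verts ?f) (verts (shape (edge_graph E c j i)))"
          using inj kB hB hi hvi by (fastforce simp: G inj_on_def)
        show "inj_on (iso_arcs ?f) (arcs (shape (edge_graph E c j i)))"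
          using ginj by (simp add: G)
      qed (use hi hvi in \<open>auto simp: G g_def\<close>)
      show "shape (edge_graph E c l k) = app_iso ?f (shape (edge_graph E c j i))"
        using gimg img' hvi by (simp add: G H app_iso_def)
    qed (use compatible_colouringD[OF comp e col] vc hi hvi gc in \<open>auto simp: G H\<close>)
  qed
qed

section \<open>The two models in coordinates\<close>

text \<open>The matrix \<open>(id - \<Lambda>)\<^sup>T \<Omega>\<^sup>-\<^sup>1 (id - \<Lambda>)\<close>, entry by entry, where \<open>lam\<close>
  holds the entries of \<open>\<Lambda>\<close> and \<open>al\<close> the diagonal of the inverse of \<open>\<Omega>\<close>.\<close>

definition rdag_matrix :: "('n::finite \<Rightarrow> 'n \<Rightarrow> real) \<Rightarrow> ('n \<Rightarrow> real) \<Rightarrow> real ^ 'n ^ 'n" where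
  "rdag_matrix lam al =
     (\<chi> i j. \<Sum>k\<in>UNIV. (of_bool (k = i) - lam k i) * al k * (of_bool (k = j) - lam k j))"

text \<open>The conditions on \<open>\<Lambda>\<close> and \<open>\<Omega>\<close> in the RDAG model, with the diagonal of \<open>\<Omega>\<close>
  replaced by its inverse.\<close>

definition rdag_params ::
    "('n \<times> 'n) set \<Rightarrow> ('n, 'c) dag_colouring \<Rightarrow> ('n \<Rightarrow> 'n \<Rightarrow> real) \<Rightarrow> ('n \<Rightarrow> real) \<Rightarrow> bool" where
  "rdag_params E c lam al \<longleftrightarrow>
     (\<forall>i j. (j, i) \<notin> E \<longrightarrow> lam i j = 0) \<and>
     (\<forall>i j k l. (j, i) \<in> E \<longrightarrow> (l, k) \<in> E \<longrightarrow> c (Inr (j, i)) = c (Inr (l, k)) \<longrightarrow> lam i j = lam k l) \<and>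
     (\<forall>i. al i > 0) \<and>
     (\<forall>i j. c (Inl i) = c (Inl j) \<longrightarrow> al i = al j)"

lemma matrix_inv_diagonal:
  fixes D :: "real ^ 'n::finite ^ 'n"
  assumes off: "\<And>i j. i \<noteq> j \<Longrightarrow> D $ i $ j = 0" and nz: "\<And>i. D $ i $ i \<noteq> 0"
  shows "matrix_inv D = (\<chi> i j. if i = j then 1 / D $ i $ i else 0)"
proof -
  let ?V = "\<chi> i j. if i = j then 1 / D $ i $ i else 0 :: real ^ 'n ^ 'n"
  have "(D ** ?V) $ i $ j = (mat 1 :: real ^ 'n ^ 'n) $ i $ j" for i j
  proof -
    have "(D ** ?V) $ i $ j = (\<Sum>k\<in>UNIV. D $ i $ k * (if k = j then 1 / D $ k $ k else 0))"
      by (simp add: matrix_matrix_mult_def)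
    also have "\<dots> = (\<Sum>k\<in>UNIV. if k = j then D $ i $ j / D $ j $ j else 0)"
      by (intro sum.cong) auto
    also have "\<dots> = D $ i $ j / D $ j $ j" by simp
    finally show ?thesis using nz off by (auto simp: mat_def)
  qed
  then have "D ** ?V = mat 1" by (simp add: vec_eq_iff)
  then have inv: "D ** ?V = mat 1" "?V ** D = mat 1"
    by (simp_all add: matrix_left_right_inverse)
  then have "D ** ?V = mat 1 \<and> ?V ** D = mat 1" ..
  then have "D ** matrix_inv D = mat 1 \<and> matrix_inv D ** D = mat 1"
    unfolding matrix_inv_def by (rule someI)
  then have "?V = ?V ** (D ** matrix_inv D)" by simp
  also have "\<dots> = (?V ** D) ** matrix_inv D" by (rule matrix_mul_assoc)
  also have "\<dots> = matrix_inv D" unfolding inv by simp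
  finally show ?thesis by simp
qed

lemma transpose_diag_mult_nth:
  fixes M :: "real ^ 'n::finite ^ 'n"
  shows "(transpose M ** (\<chi> i j. if i = j then a i else 0) ** M) $ i $ j
     = (\<Sum>k\<in>UNIV. M $ k $ i * a k * M $ k $ j)"
proof -
  have "(transpose M ** (\<chi> i j. if i = j then a i else 0)) $ i $ k = M $ k $ i * a k" for k
    by (simp add: matrix_matrix_mult_def transpose_def if_distrib cong: if_cong)
  then show ?thesis by (subst matrix_matrix_mult_def) simp
qed

lemma RDAG_eq_rdag_matrix:
  "RDAG E c = {rdag_matrix lam al | lam al. rdag_params E c lam al}"
proof (intro equalityI subsetI)
  fix P assume "P \<in> RDAG E c"
  then obtain L W where P: "P = transpose (mat 1 - L) ** matrix_inv W ** (mat 1 - L)"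
    and L0: "\<forall>i j. (j, i) \<notin> E \<longrightarrow> L $ i $ j = 0"
    and Lc: "\<forall>i j k l. (j, i) \<in> E \<longrightarrow> (l, k) \<in> E \<longrightarrow> c (Inr (j, i)) = c (Inr (l, k)) \<longrightarrow> L $ i $ j = L $ k $ l"
    and W0: "\<forall>i j. i \<noteq> j \<longrightarrow> W $ i $ j = 0" and Wp: "\<forall>i. W $ i $ i > 0"
    and Wc: "\<forall>i j. c (Inl i) = c (Inl j) \<longrightarrow> W $ i $ i = W $ j $ j"
    unfolding RDAG_def by blast
  have inv: "matrix_inv W = (\<chi> i j. if i = j then 1 / W $ i $ i else 0)"
    by (rule matrix_inv_diagonal) (use W0 Wp in \<open>auto simp: less_le\<close>)
  have "P $ i $ j = rdag_matrix (\<lambda>i j. L $ i $ j) (\<lambda>i. 1 / W $ i $ i) $ i $ j" for i j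
    unfolding P inv transpose_diag_mult_nth rdag_matrix_def
    by (auto simp: mat_def intro!: sum.cong)
  then have "P = rdag_matrix (\<lambda>i j. L $ i $ j) (\<lambda>i. 1 / W $ i $ i)"
    by (simp add: vec_eq_iff)
  moreover have "rdag_params E c (\<lambda>i j. L $ i $ j) (\<lambda>i. 1 / W $ i $ i)"
  proof -
    have "\<forall>i. 1 / W $ i $ i > 0" using Wp by simp
    moreover have "\<forall>i j. c (Inl i) = c (Inl j) \<longrightarrow> 1 / W $ i $ i = 1 / W $ j $ j"
      using Wc by metis
    ultimately show ?thesis
      unfolding rdag_params_def using L0 Lc by (intro conjI)
  qed
  ultimately show "P \<in> {rdag_matrix lam al | lam al. rdag_params E c lam al}" by blast
next
  fix P assume "P \<in> {rdag_matrix lam al | lam al. rdag_params E c lam al}"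
  then obtain lam al where P: "P = rdag_matrix lam al" and par: "rdag_params E c lam al" by blast
  define L :: "real ^ 'a ^ 'a" where "L = (\<chi> i j. lam i j)"
  define W :: "real ^ 'a ^ 'a" where "W = (\<chi> i j. if i = j then 1 / al i else 0)"
  have pos: "al i > 0" for i using par unfolding rdag_params_def by blast
  have "matrix_inv W = (\<chi> i j. if i = j then 1 / W $ i $ i else 0)"
    by (rule matrix_inv_diagonal) (use pos in \<open>auto simp: W_def less_le\<close>)
  also have "\<dots> = (\<chi> i j. if i = j then al i else 0)" by (simp add: W_def vec_eq_iff)
  finally have inv: "matrix_inv W = (\<chi> i j. if i = j then al i else 0)" .
  have "P $ i $ j = (transpose (mat 1 - L) ** matrix_inv W ** (mat 1 - L)) $ i $ j" for i j
    unfolding P inv transpose_diag_mult_nth rdag_matrix_def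
    by (auto simp: mat_def L_def intro!: sum.cong)
  then have "P = transpose (mat 1 - L) ** matrix_inv W ** (mat 1 - L)"
    by (simp add: vec_eq_iff)
  moreover have "\<forall>i j. (j, i) \<notin> E \<longrightarrow> L $ i $ j = 0"
    and "\<forall>i j k l. (j, i) \<in> E \<longrightarrow> (l, k) \<in> E \<longrightarrow> c (Inr (j, i)) = c (Inr (l, k)) \<longrightarrow> L $ i $ j = L $ k $ l"
    using par unfolding rdag_params_def L_def vec_lambda_beta by blast+
  moreover have "\<forall>i j. i \<noteq> j \<longrightarrow> W $ i $ j = 0" "\<forall>i. W $ i $ i > 0"
    using pos by (simp_all add: W_def)
  moreover have "\<forall>i j. c (Inl i) = c (Inl j) \<longrightarrow> W $ i $ i = W $ j $ j"
  proof (intro allI impI)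
    fix i j assume "c (Inl i) = c (Inl j)"
    then have "al i = al j" using par unfolding rdag_params_def by blast
    then show "W $ i $ i = W $ j $ j" by (simp add: W_def)
  qed
  ultimately show "P \<in> RDAG E c"
    unfolding RDAG_def by (intro CollectI exI[of _ L] exI[of _ W] conjI)
qed

lemma rdag_matrix_nth:
  "rdag_matrix lam al $ i $ j =
     of_bool (i = j) * al i - lam i j * al i - lam j i * al j + (\<Sum>k\<in>UNIV. lam k i * lam k j * al k)"
proof -
  have "rdag_matrix lam al $ i $ j = (\<Sum>k\<in>UNIV. (if k = i then of_bool (i = j) * al i else 0)
      - (if k = i then lam i j * al i else 0) - (if k = j then lam j i * al j else 0) + lam k i * lam k j * al k)"
    unfolding rdag_matrix_def vec_lambda_beta by (intro sum.cong) (auto simp: algebra_simps)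
  also have "\<dots> = of_bool (i = j) * al i - lam i j * al i - lam j i * al j + (\<Sum>k\<in>UNIV. lam k i * lam k j * al k)"
    unfolding sum.distrib sum_subtractf by simp
  finally show ?thesis .
qed

lemma sum_common_children:
  fixes E :: "('n::finite \<times> 'n) set"
  assumes "\<And>i j. (j, i) \<notin> E \<Longrightarrow> lam i j = 0"
  shows "(\<Sum>k\<in>UNIV. lam k i * lam k j * al k) = (\<Sum>k\<in>common_children E i j. lam k i * lam k j * (al k :: real))"
  by (rule sum.mono_neutral_right) (use assms in \<open>auto simp: common_children_def children_def\<close>)

text \<open>Colour invariance of the parameters is assumed only at the common children of \<open>i\<close> and
  \<open>j\<close>, so that the lemma applies within an induction along the vertices.\<close>

lemma sum_common_children_match:
  assumes match: "children_match E c i j k l" and comp: "compatible_colouring E c"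
    and lam: "\<And>p q r s. p \<in> common_children E i j \<Longrightarrow> (q, p) \<in> E \<Longrightarrow> (s, r) \<in> E \<Longrightarrow>
               c (Inr (q, p)) = c (Inr (s, r)) \<Longrightarrow> lam p q = lam r s"
    and al: "\<And>p r. p \<in> common_children E i j \<Longrightarrow> c (Inl p) = c (Inl r) \<Longrightarrow> al p = al r"
  shows "(\<Sum>p\<in>common_children E i j. lam p i * lam p j * al p)
       = (\<Sum>p\<in>common_children E k l. lam p k * lam p l * (al p :: real))"
proof -
  obtain h where bij: "bij_betw h (common_children E i j) (common_children E k l)"
    and h: "\<And>v. v \<in> common_children E i j \<Longrightarrow> pair_colours c k l (h v) = pair_colours c i j v"
    using match unfolding children_match_def by blast
  have "lam p i * lam p j * al p = lam (h p) k * lam (h p) l * al (h p)" if p: "p \<in> common_children E i j" for p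
  proof -
    have hp: "h p \<in> common_children E k l" using bij p by (auto dest: bij_betwE)
    have E: "(i, p) \<in> E" "(j, p) \<in> E" "(k, h p) \<in> E" "(l, h p) \<in> E"
      using p hp by (auto simp: common_children_def children_def)
    have "al p = al (h p)"
      using matched_child_vertex_colour[OF comp p hp h[OF p]] by (intro al[OF p]) simp
    moreover have "lam p i = lam (h p) k \<and> lam p j = lam (h p) l \<or> lam p i = lam (h p) l \<and> lam p j = lam (h p) k"
    proof -
      have "c (Inr (i, p)) = c (Inr (k, h p)) \<and> c (Inr (j, p)) = c (Inr (l, h p)) \<or>
            c (Inr (i, p)) = c (Inr (l, h p)) \<and> c (Inr (j, p)) = c (Inr (k, h p))"
        using h[OF p] by (auto simp: pair_colours_def doubleton_eq_iff)
      then show ?thesis using lam[OF p] E by blast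
    qed
    ultimately show ?thesis by auto
  qed
  then have "(\<Sum>p\<in>common_children E i j. lam p i * lam p j * al p)
     = (\<Sum>p\<in>common_children E i j. lam (h p) k * lam (h p) l * al (h p))"
    by (intro sum.cong) auto
  also have "\<dots> = (\<Sum>p\<in>common_children E k l. lam p k * lam p l * al p)"
    by (rule sum.reindex_bij_betw[OF bij])
  finally show ?thesis .
qed

text \<open>Membership in the RCON model in terms of directed edges; the two index orders of an undirected
  edge agree by symmetry.\<close>

lemma RCON_undirected_iff:
  fixes E :: "('n::{finite, linorder} \<times> 'n) set"
  assumes ord: "ordered_dag E"
  shows "P \<in> RCON (undirected E) (undirected_colouring E c) \<longleftrightarrow>
     sym_pos_def P \<and>
     (\<forall>i j. i \<noteq> j \<longrightarrow> (i, j) \<notin> E \<longrightarrow> (j, i) \<notin> E \<longrightarrow> P $ i $ j = 0) \<and>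
     (\<forall>i j. c (Inl i) = c (Inl j) \<longrightarrow> P $ i $ i = P $ j $ j) \<and>
     (\<forall>i j k l. (j, i) \<in> E \<longrightarrow> (l, k) \<in> E \<longrightarrow> c (Inr (j, i)) = c (Inr (l, k)) \<longrightarrow> P $ i $ j = P $ k $ l)"
    (is "_ \<longleftrightarrow> _ \<and> ?N \<and> ?V \<and> ?C")
proof -
  let ?d = "undirected_colouring E c"
  have mem: "{i, j} \<in> undirected E \<longleftrightarrow> (i, j) \<in> E \<or> (j, i) \<in> E" for i j
    by (auto simp: undirected_def doubleton_eq_iff)
  have d: "?d (Inr {i, j}) = c (Inr (i, j))" "?d (Inr {j, i}) = c (Inr (i, j))" if "(i, j) \<in> E" for i j
    using undirected_colouring_Inr[OF ord that] by (simp_all add: insert_commute)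
  have edges: "(\<forall>i j k l. {i, j} \<in> undirected E \<longrightarrow> {k, l} \<in> undirected E \<longrightarrow>
          ?d (Inr {i, j}) = ?d (Inr {k, l}) \<longrightarrow> P $ i $ j = P $ k $ l) \<longleftrightarrow> ?C" (is "?U \<longleftrightarrow> _")
    if sym: "\<And>i j. P $ i $ j = P $ j $ i"
  proof
    assume U: ?U
    show ?C
    proof (intro allI impI)
      fix i j k l assume "(j, i) \<in> E" "(l, k) \<in> E" "c (Inr (j, i)) = c (Inr (l, k))"
      then show "P $ i $ j = P $ k $ l" using U[rule_format, of i j k l] by (simp add: mem d)
    qed
  next
    assume C: ?C
    show ?U
    proof (intro allI impI)
      fix i j k l assume *: "{i, j} \<in> undirected E" "{k, l} \<in> undirected E"
        "?d (Inr {i, j}) = ?d (Inr {k, l})"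
      obtain p q where pq: "(q, p) \<in> E" "{i, j} = {p, q}"
        using *(1) by (auto simp: mem)
      obtain r s where rs: "(s, r) \<in> E" "{k, l} = {r, s}"
        using *(2) by (auto simp: mem)
      have "P $ p $ q = P $ r $ s"
        using *(3) pq rs by (intro C[rule_format]) (simp_all add: d)
      moreover have "P $ i $ j = P $ p $ q"
        using pq(2) sym[of p q] by (auto simp: doubleton_eq_iff)
      moreover have "P $ k $ l = P $ r $ s"
        using rs(2) sym[of r s] by (auto simp: doubleton_eq_iff)
      ultimately show "P $ i $ j = P $ k $ l" by simp
    qed
  qed
  have non_edges: "(\<forall>i j. i \<noteq> j \<longrightarrow> {i, j} \<notin> undirected E \<longrightarrow> P $ i $ j = 0) \<longleftrightarrow> ?N"
    unfolding mem de_Morgan_disj by blast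
  have vertices: "?d (Inl i) = c (Inl i)" for i by (simp add: undirected_colouring_def)
  show ?thesis
  proof (cases "sym_pos_def P")
    case True
    have "P $ i $ j = P $ j $ i" for i j
    proof -
      have "transpose P $ i $ j = P $ i $ j" using True by (simp add: sym_pos_def_def)
      then show ?thesis by (simp add: transpose_def)
    qed
    then show ?thesis
      unfolding RCON_def mem_Collect_eq by (simp only: edges non_edges vertices)
  qed (simp add: RCON_def)
qed

lemma rdag_matrix_sym_pos_def:
  fixes E :: "('n::{finite, linorder} \<times> 'n) set"
  assumes ord: "ordered_dag E" and par: "rdag_params E c lam al"
  shows "sym_pos_def (rdag_matrix lam al)"
  unfolding sym_pos_def_def
proof (intro conjI allI impI)
  show "transpose (rdag_matrix lam al) = rdag_matrix lam al"
    by (simp add: vec_eq_iff transpose_def rdag_matrix_def mult.assoc mult.left_commute mult.commute)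
next
  fix x :: "(real, 'n) vec" assume "x \<noteq> 0"
  define y where "y k = (\<Sum>i\<in>UNIV. (of_bool (k = i) - lam k i) * x $ i)" for k
  have "x \<bullet> (rdag_matrix lam al *v x) =
      (\<Sum>i\<in>UNIV. \<Sum>j\<in>UNIV. \<Sum>k\<in>UNIV. al k * (((of_bool (k = i) - lam k i) * x $ i) * ((of_bool (k = j) - lam k j) * x $ j)))"
    unfolding inner_vec_def matrix_vector_mult_def rdag_matrix_def
    by (simp add: sum_distrib_left sum_distrib_right mult_ac)
  also have "\<dots> = (\<Sum>i\<in>UNIV. \<Sum>k\<in>UNIV. \<Sum>j\<in>UNIV. al k * (((of_bool (k = i) - lam k i) * x $ i) * ((of_bool (k = j) - lam k j) * x $ j)))"
    by (intro sum.cong refl sum.swap)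
  also have "\<dots> = (\<Sum>k\<in>UNIV. \<Sum>i\<in>UNIV. \<Sum>j\<in>UNIV. al k * (((of_bool (k = i) - lam k i) * x $ i) * ((of_bool (k = j) - lam k j) * x $ j)))"
    by (rule sum.swap)
  also have "\<dots> = (\<Sum>k\<in>UNIV. al k * (y k * y k))"
    unfolding y_def sum_product by (simp add: sum_distrib_left)
  finally have eq: "x \<bullet> (rdag_matrix lam al *v x) = (\<Sum>k\<in>UNIV. al k * (y k * y k))" .
  have pos: "al k > 0" for k using par unfolding rdag_params_def by blast
  have lam0: "lam i j = 0" if "(j, i) \<notin> E" for i j
    using par that unfolding rdag_params_def by blast
  \<comment> \<open>\<open>y = (id - \<Lambda>) x\<close> agrees with \<open>x\<close> at the largest index of the support of \<open>x\<close>.\<close>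
  define m where "m = Max {i. x $ i \<noteq> 0}"
  have ne: "{i. x $ i \<noteq> 0} \<noteq> {}" using \<open>x \<noteq> 0\<close> by (auto simp: vec_eq_iff)
  have xm: "x $ m \<noteq> 0" using Max_in[OF _ ne] by (simp add: m_def)
  have "y m = (\<Sum>i\<in>UNIV. if i = m then x $ m else 0)"
    unfolding y_def
  proof (rule sum.cong[OF refl])
    fix i
    have "lam m i * x $ i = 0"
    proof (cases "(i, m) \<in> E")
      case True
      then have "m < i" using ord by (rule ordered_dagD[rotated])
      then have "x $ i = 0"
        using Max_ge[of "{i. x $ i \<noteq> 0}" i] unfolding m_def by (meson finite leD mem_Collect_eq)
      then show ?thesis by simp
    qed (use lam0 in simp)
    then show "(of_bool (m = i) - lam m i) * x $ i = (if i = m then x $ m else 0)"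
      by (auto simp: algebra_simps)
  qed
  then have "y m = x $ m" by simp
  with xm have "y m * y m > 0" by (metis not_square_less_zero mult_eq_0_iff linorder_neqE_linordered_idom)
  then have "al m * (y m * y m) > 0" using pos by simp
  also have "al m * (y m * y m) \<le> (\<Sum>k\<in>UNIV. al k * (y k * y k))"
    by (rule member_le_sum) (use pos in \<open>auto simp: less_imp_le\<close>)
  finally show "x \<bullet> (rdag_matrix lam al *v x) > 0" using eq by simp
qed

section \<open>When the directed model lies in the undirected one\<close>

lemma RDAG_subset_RCON_iff:
  fixes E :: "('n::{finite, linorder} \<times> 'n) set"
  assumes ord: "ordered_dag E" and comp: "compatible_colouring E c"
  shows "RDAG E c \<subseteq> RCON (undirected E) (undirected_colouring E c) \<longleftrightarrow>
     (\<nexists>i j k. unshielded_collider E i j k) \<and>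
     (\<forall>i j. c (Inl i) = c (Inl j) \<longrightarrow> children_match E c i i j j) \<and>
     (\<forall>i j k l. (j, i) \<in> E \<longrightarrow> (l, k) \<in> E \<longrightarrow> c (Inr (j, i)) = c (Inr (l, k)) \<longrightarrow> children_match E c i j k l)"
proof
  assume sub: "RDAG E c \<subseteq> RCON (undirected E) (undirected_colouring E c)"
  \<comment> \<open>Test parameters: \<open>\<lambda>\<close> is 1 on the edges with a colour in \<open>S\<close> and 0 elsewhere.\<close>
  define lam where "lam S k i = (of_bool ((i, k) \<in> E \<and> c (Inr (i, k)) \<in> S) :: real)" for S k i
  have "rdag_params E c (lam S) (\<lambda>_. 1)" for S
    by (auto simp: rdag_params_def lam_def)
  then have "rdag_matrix (lam S) (\<lambda>_. 1) \<in> RDAG E c" for S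
    by (auto simp: RDAG_eq_rdag_matrix)
  with sub have "rdag_matrix (lam S) (\<lambda>_. 1) \<in> RCON (undirected E) (undirected_colouring E c)" for S
    by blast
  note R = this[unfolded RCON_undirected_iff[OF ord]]
  define N where "N S i j = card {v \<in> common_children E i j. pair_colours c i j v \<subseteq> S}" for S i j
  have "(\<Sum>k\<in>UNIV. lam S k i * lam S k j * 1) = real (N S i j)" for S i j
  proof -
    have "(\<Sum>k\<in>UNIV. lam S k i * lam S k j * 1) =
        (\<Sum>k\<in>UNIV. if k \<in> {v \<in> common_children E i j. pair_colours c i j v \<subseteq> S} then 1 else 0)"
      by (intro sum.cong) (auto simp: lam_def common_children_def children_def pair_colours_def)
    then show ?thesis by (simp add: N_def sum.If_cases)
  qed
  then have nth: "rdag_matrix (lam S) (\<lambda>_. 1) $ i $ j =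
      of_bool (i = j) - lam S i j - lam S j i + real (N S i j)" for S i j
    by (simp add: rdag_matrix_nth)
  have irr: "(i, i) \<notin> E" for i using ordered_dagD[OF ord, of i i] by auto
  have asym: "(j, i) \<in> E \<Longrightarrow> (i, j) \<notin> E" for i j
    using ordered_dagD[OF ord, of i j] ordered_dagD[OF ord, of j i] by auto
  show "(\<nexists>i j k. unshielded_collider E i j k) \<and>
     (\<forall>i j. c (Inl i) = c (Inl j) \<longrightarrow> children_match E c i i j j) \<and>
     (\<forall>i j k l. (j, i) \<in> E \<longrightarrow> (l, k) \<in> E \<longrightarrow> c (Inr (j, i)) = c (Inr (l, k)) \<longrightarrow> children_match E c i j k l)"
  proof (intro conjI allI impI notI)
    assume "\<exists>i j k. unshielded_collider E i j k"
    then obtain i j k where u: "unshielded_collider E i j k" by blast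
    then have "rdag_matrix (lam UNIV) (\<lambda>_. 1) $ i $ j = 0"
      using R[of UNIV] by (auto simp: unshielded_collider_def)
    then have "N UNIV i j = 0"
      using u by (simp add: nth lam_def unshielded_collider_def)
    moreover have "k \<in> common_children E i j"
      using u by (auto simp: unshielded_collider_def common_children_def children_def)
    ultimately show False by (auto simp: N_def)
  next
    fix i j assume "c (Inl i) = c (Inl j)"
    then have "rdag_matrix (lam S) (\<lambda>_. 1) $ i $ i = rdag_matrix (lam S) (\<lambda>_. 1) $ j $ j" for S
      using R[of S] by blast
    then have "N S i i = N S j j" for S
      by (simp add: nth lam_def irr)
    then show "children_match E c i i j j"
      by (intro children_match_from_counts) (simp add: N_def)
  next
    fix i j k l assume e: "(j, i) \<in> E" "(l, k) \<in> E" and col: "c (Inr (j, i)) = c (Inr (l, k))"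
    have "rdag_matrix (lam S) (\<lambda>_. 1) $ i $ j = rdag_matrix (lam S) (\<lambda>_. 1) $ k $ l" for S
      using R[of S] e col by blast
    moreover have "i \<noteq> j" "k \<noteq> l" using irr e by auto
    ultimately have "N S i j = N S k l" for S
      using e col asym[OF e(1)] asym[OF e(2)] by (simp add: nth lam_def)
    then show "children_match E c i j k l"
      by (intro children_match_from_counts) (simp add: N_def)
  qed
next
  assume "(\<nexists>i j k. unshielded_collider E i j k) \<and>
     (\<forall>i j. c (Inl i) = c (Inl j) \<longrightarrow> children_match E c i i j j) \<and>
     (\<forall>i j k l. (j, i) \<in> E \<longrightarrow> (l, k) \<in> E \<longrightarrow> c (Inr (j, i)) = c (Inr (l, k)) \<longrightarrow> children_match E c i j k l)"
  then have a: "\<And>i j k. \<not> unshielded_collider E i j k"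
    and b: "\<And>i j. c (Inl i) = c (Inl j) \<Longrightarrow> children_match E c i i j j"
    and d: "\<And>i j k l. (j, i) \<in> E \<Longrightarrow> (l, k) \<in> E \<Longrightarrow> c (Inr (j, i)) = c (Inr (l, k)) \<Longrightarrow> children_match E c i j k l"
    by blast+
  show "RDAG E c \<subseteq> RCON (undirected E) (undirected_colouring E c)"
  proof
    fix P assume "P \<in> RDAG E c"
    then obtain lam al where P: "P = rdag_matrix lam al" and par: "rdag_params E c lam al"
      by (auto simp: RDAG_eq_rdag_matrix)
    have lam0: "\<And>i j. (j, i) \<notin> E \<Longrightarrow> lam i j = 0"
      and lamc: "\<And>i j k l. (j, i) \<in> E \<Longrightarrow> (l, k) \<in> E \<Longrightarrow> c (Inr (j, i)) = c (Inr (l, k)) \<Longrightarrow> lam i j = lam k l"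
      and alc: "\<And>i j. c (Inl i) = c (Inl j) \<Longrightarrow> al i = al j"
      using par unfolding rdag_params_def by blast+
    have nth: "P $ i $ j = of_bool (i = j) * al i - lam i j * al i - lam j i * al j
        + (\<Sum>k\<in>common_children E i j. lam k i * lam k j * al k)" for i j
      unfolding P rdag_matrix_nth using sum_common_children[of E lam, OF lam0] by simp
    have irr: "lam i i = 0" for i using lam0 ordered_dagD[OF ord, of i i] by auto
    have asym: "lam j i = 0" if "(j, i) \<in> E" for i j
      using lam0[of i j] ordered_dagD[OF ord, of i j] ordered_dagD[OF ord that] by (meson less_asym)
    have sums: "(\<Sum>p\<in>common_children E i j. lam p i * lam p j * al p)
       = (\<Sum>p\<in>common_children E k l. lam p k * lam p l * al p)" if "children_match E c i j k l" for i j k l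
      by (rule sum_common_children_match[OF that comp]) (use lamc alc in blast)+
    show "P \<in> RCON (undirected E) (undirected_colouring E c)"
      unfolding RCON_undirected_iff[OF ord]
    proof (intro conjI allI impI)
      show "sym_pos_def P" unfolding P by (rule rdag_matrix_sym_pos_def[OF ord par])
    next
      fix i j assume *: "i \<noteq> j" "(i, j) \<notin> E" "(j, i) \<notin> E"
      have "common_children E i j = {}"
      proof (rule ccontr)
        assume "common_children E i j \<noteq> {}"
        then obtain k where "(i, k) \<in> E" "(j, k) \<in> E" by (auto simp: common_children_def children_def)
        then have "unshielded_collider E i j k"
          using * by (auto simp: unshielded_collider_def)
        with a show False by blast
      qed
      with * show "P $ i $ j = 0" by (simp add: nth lam0)
    next
      fix i j assume col: "c (Inl i) = c (Inl j)"
      then show "P $ i $ i = P $ j $ j"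
        using sums[OF b[OF col]] alc[OF col] by (simp add: nth irr)
    next
      fix i j k l assume e: "(j, i) \<in> E" "(l, k) \<in> E" and col: "c (Inr (j, i)) = c (Inr (l, k))"
      have "i \<noteq> j" "k \<noteq> l" using ordered_dagD[OF ord e(1)] ordered_dagD[OF ord e(2)] by auto
      then show "P $ i $ j = P $ k $ l"
        using alc[OF compatible_colouringD[OF comp e col]] lamc[OF e col] sums[OF d[OF e col]]
          asym[OF e(1)] asym[OF e(2)] by (simp add: nth)
    qed
  qed
qed

section \<open>Factorising a positive definite matrix\<close>

text \<open>The proof splits off the smallest index and factors the Schur complement of its pivot.\<close>

lemma LDL_factorisation:
  fixes A :: "'n::linorder \<Rightarrow> 'n \<Rightarrow> real"
  assumes "finite S" and "\<And>i j. A i j = A j i"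
    and "\<And>x. \<exists>i\<in>S. x i \<noteq> 0 \<Longrightarrow> 0 < (\<Sum>i\<in>S. \<Sum>j\<in>S. x i * A i j * x j)"
  shows "\<exists>M al. (\<forall>k\<in>S. al k > 0 \<and> M k k = 1) \<and> (\<forall>k\<in>S. \<forall>i\<in>S. i < k \<longrightarrow> M k i = 0) \<and>
     (\<forall>i\<in>S. \<forall>j\<in>S. A i j = (\<Sum>k\<in>S. M k i * al k * M k j))"
  using assms
proof (induction S arbitrary: A rule: finite_linorder_min_induct)
  case empty
  then show ?case by simp
next
  case (insert b S)
  note sym = insert.prems(1) and pd = insert.prems(2)
  have bS: "b \<notin> S" using insert.hyps by auto
  have expand: "(\<Sum>i\<in>insert b S. \<Sum>j\<in>insert b S. x i * A i j * x j) =
     x b * A b b * x b + 2 * (x b * (\<Sum>j\<in>S. A b j * x j)) + (\<Sum>i\<in>S. \<Sum>j\<in>S. x i * A i j * x j)" for x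
  proof -
    have "(\<Sum>i\<in>S. x i * A i b * x b) = x b * (\<Sum>j\<in>S. A b j * x j)"
      unfolding sum_distrib_left by (intro sum.cong) (auto simp: sym[of _ b])
    moreover have "(\<Sum>j\<in>S. x b * A b j * x j) = x b * (\<Sum>j\<in>S. A b j * x j)"
      by (simp add: sum_distrib_left mult.assoc)
    ultimately show ?thesis
      using bS insert.hyps(1) by (simp add: sum.distrib)
  qed
  define p where "p = A b b"
  have p: "p > 0"
  proof -
    have "0 < (\<Sum>i\<in>insert b S. \<Sum>j\<in>insert b S. of_bool (i = b) * A i j * of_bool (j = b))"
      by (rule pd) auto
    also have "\<dots> = p"
    proof -
      have "(\<Sum>j\<in>S. A b j * of_bool (j = b)) = 0" "(\<Sum>i\<in>S. \<Sum>j\<in>S. of_bool (i = b) * A i j * of_bool (j = b)) = 0"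
        using bS by (auto intro!: sum.neutral)
      then show ?thesis unfolding expand[of "\<lambda>i. of_bool (i = b)"] by (simp add: p_def)
    qed
    finally show ?thesis .
  qed
  define A' where "A' i j = A i j - A b i * A b j / p" for i j
  have "\<exists>M al. (\<forall>k\<in>S. al k > 0 \<and> M k k = 1) \<and> (\<forall>k\<in>S. \<forall>i\<in>S. i < k \<longrightarrow> M k i = 0) \<and>
     (\<forall>i\<in>S. \<forall>j\<in>S. A' i j = (\<Sum>k\<in>S. M k i * al k * M k j))"
  proof (rule insert.IH)
    show "A' i j = A' j i" for i j by (simp add: A'_def sym[of i j] mult.commute)
  next
    fix x :: "'n \<Rightarrow> real" assume x: "\<exists>i\<in>S. x i \<noteq> 0"
    define s where "s = (\<Sum>j\<in>S. A b j * x j)"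
    \<comment> \<open>This value at \<open>b\<close> minimises the quadratic form over the extensions of \<open>x\<close>; the minimum
      is the Schur complement form at \<open>x\<close>.\<close>
    define y where "y = x(b := - s / p)"
    have yS: "y i = x i" if "i \<in> S" for i using bS that by (auto simp: y_def)
    have "0 < (\<Sum>i\<in>insert b S. \<Sum>j\<in>insert b S. y i * A i j * y j)"
      using x yS by (intro pd) auto
    also have "\<dots> = y b * p * y b + 2 * (y b * s) + (\<Sum>i\<in>S. \<Sum>j\<in>S. x i * A i j * x j)"
      unfolding expand by (simp add: yS s_def p_def cong: sum.cong)
    also have "\<dots> = (\<Sum>i\<in>S. \<Sum>j\<in>S. x i * A i j * x j) - s * s / p"
      using p by (simp add: y_def field_simps)
    also have "s * s / p = (\<Sum>i\<in>S. \<Sum>j\<in>S. x i * (A b i * A b j / p) * x j)"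
      unfolding s_def sum_product by (simp add: sum_divide_distrib mult_ac)
    also have "(\<Sum>i\<in>S. \<Sum>j\<in>S. x i * A i j * x j) - \<dots> = (\<Sum>i\<in>S. \<Sum>j\<in>S. x i * A' i j * x j)"
      by (simp add: A'_def sum_subtractf algebra_simps)
    finally show "0 < (\<Sum>i\<in>S. \<Sum>j\<in>S. x i * A' i j * x j)" .
  qed
  then obtain M al where M: "\<forall>k\<in>S. al k > 0 \<and> M k k = 1" "\<forall>k\<in>S. \<forall>i\<in>S. i < k \<longrightarrow> M k i = 0"
    and A': "\<And>i j. i \<in> S \<Longrightarrow> j \<in> S \<Longrightarrow> A' i j = (\<Sum>k\<in>S. M k i * al k * M k j)" by blast
  define M' where "M' k i = (if k = b then A b i / p else if i = b then 0 else M k i)" for k i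
  define al' where "al' = al(b := p)"
  have off: "M' k i * al' k * M' k j = (if i = b \<or> j = b then 0 else M k i * al k * M k j)" if "k \<in> S" for i j k
    using that bS by (auto simp: M'_def al'_def)
  have nb: "i \<noteq> b" if "i \<in> S" for i using that bS by auto
  have "A i j = (\<Sum>k\<in>insert b S. M' k i * al' k * M' k j)" if ij: "i \<in> insert b S" "j \<in> insert b S" for i j
  proof -
    have "(\<Sum>k\<in>insert b S. M' k i * al' k * M' k j) = A b i * A b j / p
        + (\<Sum>k\<in>S. if i = b \<or> j = b then 0 else M k i * al k * M k j)"
      using bS insert.hyps(1) p by (simp add: off cong: sum.cong) (simp add: M'_def al'_def)
    also have "\<dots> = A i j"
    proof (cases "i = b \<or> j = b")
      case True
      then have "A b i * A b j = p * A i j" using sym[of i b] by (auto simp: p_def)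
      then show ?thesis using True p by (auto intro!: sum.neutral)
    next
      case False
      then show ?thesis using ij A'[of i j] by (simp add: A'_def)
    qed
    finally show ?thesis by simp
  qed
  moreover have "\<forall>k\<in>insert b S. al' k > 0 \<and> M' k k = 1"
    using M p nb by (auto simp: M'_def al'_def p_def)
  moreover have "\<forall>k\<in>insert b S. \<forall>i\<in>insert b S. i < k \<longrightarrow> M' k i = 0"
    using M insert.hyps by (auto simp: M'_def)
  ultimately show ?case by blast
qed

lemma sym_pos_def_eq_rdag_matrix:
  fixes P :: "real ^ ('n::{finite, linorder}) ^ ('n::{finite, linorder})"
  assumes "sym_pos_def P"
  obtains lam al where "P = rdag_matrix lam al" "\<And>i. al i > 0" "\<And>i j. \<not> i < j \<Longrightarrow> lam i j = 0"
proof -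
  have tr: "transpose P = P" and pd: "\<And>x. x \<noteq> 0 \<Longrightarrow> x \<bullet> (P *v x) > 0"
    using assms by (auto simp: sym_pos_def_def)
  have sym: "P $ i $ j = P $ j $ i" for i j
    using arg_cong[OF tr, of "\<lambda>Q. Q $ j $ i"] by (simp add: transpose_def)
  have "\<exists>M al. (\<forall>k\<in>UNIV. al k > 0 \<and> M k k = 1) \<and> (\<forall>k\<in>UNIV. \<forall>i\<in>UNIV. i < k \<longrightarrow> M k i = 0) \<and>
     (\<forall>i\<in>UNIV. \<forall>j\<in>UNIV. P $ i $ j = (\<Sum>k\<in>UNIV. M k i * al k * M k j))"
  proof (rule LDL_factorisation)
    fix x :: "'n \<Rightarrow> real" assume "\<exists>i\<in>UNIV. x i \<noteq> 0"
    then have "(\<chi> i. x i) \<noteq> 0" by (auto simp: vec_eq_iff)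
    from pd[OF this] show "0 < (\<Sum>i\<in>UNIV. \<Sum>j\<in>UNIV. x i * P $ i $ j * x j)"
      by (simp add: inner_vec_def matrix_vector_mult_def sum_distrib_left mult.assoc)
  qed (use sym in auto)
  then obtain M al where al: "\<And>k. al k > 0" and M: "\<And>k. M k k = 1" "\<And>k i. i < k \<Longrightarrow> M k i = 0"
    and P: "\<And>i j. P $ i $ j = (\<Sum>k\<in>UNIV. M k i * al k * M k j)" by blast
  define lam where "lam k i = of_bool (k = i) - M k i" for k i
  have "P = rdag_matrix lam al"
    by (simp add: vec_eq_iff rdag_matrix_def P lam_def)
  moreover have "lam i j = 0" if "\<not> i < j" for i j
    using that M by (cases "i = j") (auto simp: lam_def)
  ultimately show ?thesis using that al by blast
qed

section \<open>When the undirected model lies in the directed one\<close>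

lemma finite_linorder_less_induct [case_names less]:
  fixes i :: "'n::{finite, linorder}"
  assumes "\<And>i. (\<And>k. k < i \<Longrightarrow> Q k) \<Longrightarrow> Q i"
  shows "Q i"
proof (induction "card {..<i}" arbitrary: i rule: less_induct)
  case less
  show ?case
  proof (rule assms)
    fix k assume "k < i"
    then have "{..<k} \<subset> {..<i}" by auto
    then show "Q k" by (intro less psubset_card_mono) auto
  qed
qed

lemma RCON_subset_RDAG:
  fixes E :: "('n::{finite, linorder} \<times> 'n) set"
  assumes ord: "ordered_dag E" and comp: "compatible_colouring E c"
    and a: "\<And>i j k. \<not> unshielded_collider E i j k"
    and b: "\<And>i j. c (Inl i) = c (Inl j) \<Longrightarrow> children_match E c i i j j"
    and d: "\<And>i j k l. (j, i) \<in> E \<Longrightarrow> (l, k) \<in> E \<Longrightarrow> c (Inr (j, i)) = c (Inr (l, k)) \<Longrightarrow> children_match E c i j k l"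
  shows "RCON (undirected E) (undirected_colouring E c) \<subseteq> RDAG E c"
proof
  fix P assume "P \<in> RCON (undirected E) (undirected_colouring E c)"
  note R = this[unfolded RCON_undirected_iff[OF ord]]
  have spd: "sym_pos_def P" using R by (rule conjunct1)
  have P0: "\<And>i j. i \<noteq> j \<Longrightarrow> (i, j) \<notin> E \<Longrightarrow> (j, i) \<notin> E \<Longrightarrow> P $ i $ j = 0"
    by (rule R[THEN conjunct2, THEN conjunct1, rule_format])
  have Pv: "\<And>i j. c (Inl i) = c (Inl j) \<Longrightarrow> P $ i $ i = P $ j $ j"
    by (rule R[THEN conjunct2, THEN conjunct2, THEN conjunct1, rule_format])
  have Pe: "\<And>i j k l. (j, i) \<in> E \<Longrightarrow> (l, k) \<in> E \<Longrightarrow> c (Inr (j, i)) = c (Inr (l, k)) \<Longrightarrow> P $ i $ j = P $ k $ l"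
    by (rule R[THEN conjunct2, THEN conjunct2, THEN conjunct2, rule_format])
  obtain lam al where P: "P = rdag_matrix lam al" and al: "\<And>i. al i > 0"
    and tri: "\<And>i j. \<not> i < j \<Longrightarrow> lam i j = 0"
    using sym_pos_def_eq_rdag_matrix[OF spd] by blast
  \<comment> \<open>If \<open>i\<close> and \<open>j\<close> are not adjacent, a nonzero term of the sum in entry \<open>(i, j)\<close> would
    give an unshielded collider \<open>i \<rightarrow> k \<leftarrow> j\<close>, by the induction hypothesis for \<open>k < i\<close>.\<close>
  have supp: "\<forall>j. (j, i) \<notin> E \<longrightarrow> lam i j = 0" for i
  proof (induction i rule: finite_linorder_less_induct)
    case (less i)
    show ?case
    proof (intro allI impI)
      fix j assume ji: "(j, i) \<notin> E"
      show "lam i j = 0"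
      proof (cases "i < j")
        case True
        then have ij: "(i, j) \<notin> E" using ordered_dagD[OF ord, of i j] by auto
        have "lam k i * lam k j * al k = 0" for k
        proof (rule ccontr)
          assume nz: "lam k i * lam k j * al k \<noteq> 0"
          then have "k < i" using tri[of k i] by auto
          with less nz have "(i, k) \<in> E" "(j, k) \<in> E" by auto
          moreover have "k \<noteq> i" "k \<noteq> j" "i \<noteq> j" using \<open>k < i\<close> True by auto
          ultimately have "unshielded_collider E i j k"
            using ij ji by (simp add: unshielded_collider_def)
          with a show False by blast
        qed
        then have "(\<Sum>k\<in>UNIV. lam k i * lam k j * al k) = 0" by (intro sum.neutral) blast
        then have "P $ i $ j = - lam i j * al i"
          using True tri[of j i] unfolding P rdag_matrix_nth by auto
        moreover have "P $ i $ j = 0" using P0[of i j] ij ji True by auto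
        ultimately show ?thesis using al[of i] by auto
      qed (rule tri)
    qed
  qed
  have nth: "P $ i $ j = of_bool (i = j) * al i - lam i j * al i - lam j i * al j
        + (\<Sum>k\<in>common_children E i j. lam k i * lam k j * al k)" for i j
    unfolding P rdag_matrix_nth using sum_common_children[of E lam] supp by simp
  \<comment> \<open>Only \<open>i\<close> is the induction variable: the other vertex or edge of the same colour is arbitrary,
    and its children are reached through a matching.\<close>
  have "(\<forall>i'. c (Inl i) = c (Inl i') \<longrightarrow> al i = al i') \<and>
        (\<forall>j k l. (j, i) \<in> E \<longrightarrow> (l, k) \<in> E \<longrightarrow> c (Inr (j, i)) = c (Inr (l, k)) \<longrightarrow> lam i j = lam k l)" for i
  proof (induction i rule: finite_linorder_less_induct)
    case (less i)
    have lt: "p < i" if "p \<in> common_children E i j" for p j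
      using that ordered_dagD[OF ord, of i p] by (auto simp: common_children_def children_def)
    have sums: "(\<Sum>p\<in>common_children E i j. lam p i * lam p j * al p)
       = (\<Sum>p\<in>common_children E k l. lam p k * lam p l * al p)" if "children_match E c i j k l" for j k l
      by (rule sum_common_children_match[OF that comp]) (use less lt in blast)+
    have v: "al i = al i'" if "c (Inl i) = c (Inl i')" for i'
      using Pv[OF that] sums[OF b[OF that]] tri by (simp add: nth)
    moreover have "lam i j = lam k l"
      if e: "(j, i) \<in> E" "(l, k) \<in> E" and col: "c (Inr (j, i)) = c (Inr (l, k))" for j k l
    proof -
      have "al i = al k" using v compatible_colouringD[OF comp e col] by blast
      moreover have "lam j i = 0" "lam l k = 0" "i \<noteq> j" "k \<noteq> l"
        using tri ordered_dagD[OF ord e(1)] ordered_dagD[OF ord e(2)] by auto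
      ultimately have "lam i j * al i = lam k l * al i"
        using Pe[OF e col] sums[OF d[OF e col]] by (simp add: nth)
      then show ?thesis using al[of i] by simp
    qed
    ultimately show ?case by blast
  qed
  then have "\<And>i j. c (Inl i) = c (Inl j) \<Longrightarrow> al i = al j"
    and "\<And>i j k l. (j, i) \<in> E \<Longrightarrow> (l, k) \<in> E \<Longrightarrow> c (Inr (j, i)) = c (Inr (l, k)) \<Longrightarrow> lam i j = lam k l"
    by blast+
  then have "rdag_params E c lam al"
    unfolding rdag_params_def using supp al by (intro conjI allI impI) blast+
  then show "P \<in> RDAG E c" using P by (auto simp: RDAG_eq_rdag_matrix)
qed

section \<open>Equality of the models\<close>

theorem theorem3p4:
  fixes E :: "('n::{finite, linorder} \<times> 'n) set"
    and c :: "'n + 'n \<times> 'n \<Rightarrow> 'c"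
  assumes "ordered_dag E" and "compatible_colouring E c"
  shows "RDAG E c = RCON (undirected E) (undirected_colouring E c) \<longleftrightarrow>
      (\<nexists>i j k. unshielded_collider E i j k) \<and>
      (\<forall>i j. c (Inl i) = c (Inl j) \<longrightarrow>
         coloured_iso (vertex_graph E c i) (vertex_graph E c j)) \<and>
      (\<forall>i j k l. (j, i) \<in> E \<longrightarrow> (l, k) \<in> E \<longrightarrow> c (Inr (j, i)) = c (Inr (l, k)) \<longrightarrow>
         coloured_iso (edge_graph E c j i) (edge_graph E c l k))"
proof -
  let ?M = "(\<nexists>i j k. unshielded_collider E i j k) \<and>
     (\<forall>i j. c (Inl i) = c (Inl j) \<longrightarrow> children_match E c i i j j) \<and>
     (\<forall>i j k l. (j, i) \<in> E \<longrightarrow> (l, k) \<in> E \<longrightarrow> c (Inr (j, i)) = c (Inr (l, k)) \<longrightarrow> children_match E c i j k l)"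
  have "RDAG E c = RCON (undirected E) (undirected_colouring E c) \<longleftrightarrow> ?M"
  proof
    assume "RDAG E c = RCON (undirected E) (undirected_colouring E c)"
    then show ?M using RDAG_subset_RCON_iff[OF assms] by blast
  next
    assume M: ?M
    then have "RCON (undirected E) (undirected_colouring E c) \<subseteq> RDAG E c"
      by (intro RCON_subset_RDAG[OF assms]) blast+
    with M show "RDAG E c = RCON (undirected E) (undirected_colouring E c)"
      using RDAG_subset_RCON_iff[OF assms] by blast
  qed
  also have "?M \<longleftrightarrow> (\<nexists>i j k. unshielded_collider E i j k) \<and>
      (\<forall>i j. c (Inl i) = c (Inl j) \<longrightarrow>
         coloured_iso (vertex_graph E c i) (vertex_graph E c j)) \<and>
      (\<forall>i j k l. (j, i) \<in> E \<longrightarrow> (l, k) \<in> E \<longrightarrow> c (Inr (j, i)) = c (Inr (l, k)) \<longrightarrow>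
         coloured_iso (edge_graph E c j i) (edge_graph E c l k))"
    using vertex_iso_iff[OF assms] edge_iso_iff[OF assms] by meson
  finally show ?thesis .
qed

end
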